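(* Every finite semidistrim lattice is crosscut simplicial.
   Context: All lattices are finite. For a lattice $L$, $\mathcal{J}_L$ (resp. $\mathcal{M}_L$) is the set of join-irreducible (resp. meet-irreducible) elements; for $j\in\mathcal{J}_L$, $j_*$ is the unique element covered by $j$, and for $m\in\mathcal{M}_L$, $m^*$ is the unique element covering $m$. Let $\mathcal{M}_L(j)=\max\{z\in L: j_*=j\wedge z\}$ and $\mathcal{J}_L(m)=\min\{z\in L: m^*=m\vee z\}$. A pairing on $L$ is a bijection $\kappa:\mathcal{J}_L\to\mathcal{M}_L$ with $\kappa(j)\in\mathcal{M}_L(j)$ for all $j$ and $\kappa^{-1}(m)\in\mathcal{J}_L(m)$ for all $m$; $L$ is uniquely paired if it has exactly one pairing, denoted $\kappa_L$. A prime pair is a pair $(j_0,m_0)$ with $L=[\hat0,m_0]\sqcup[j_0,\hat1]$. A uniquely paired lattice $L$ is compatibly dismantlable if $|L|=1$ or there is a prime pair $(j_0,m_0)$ such that: (i) $[j_0,\hat1]$ is compatibly dismantlable and $\alpha(j)=j_0\vee j$ defines a bijection $\{j\in\mathcal{J}_L: j_0\le\kappa_L(j)\}\to\mathcal{J}_{[j_0,\hat1]}$ with $\kappa_{[j_0,\hat1]}(\alpha(j))=\kappa_L(j)$; (ii) $[\hat0,m_0]$ is compatibly dismantlable and $\beta(m)=m_0\wedge m$ defines a bijection $\{m\in\mathcal{M}_L:\kappa_L^{-1}(m)\le m_0\}\to\mathcal{M}_{[\hat0,m_0]}$ with $\kappa_{[\hat0,m_0]}^{-1}(\beta(m))=\kappa_L^{-1}(m)$.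 The Galois graph $G_L$ is the directed graph on $\mathcal{J}_L$ with an edge $j\to j'$ iff $j\ne j'$ and $j\not\le\kappa_L(j')$. For $x\in L$ let $J_L(x)=\{j\in\mathcal{J}_L:j\le x\}$ and $M_L(x)=\{j\in\mathcal{J}_L:\kappa_L(j)\ge x\}$. For a compatibly dismantlable $L$, for every cover $x\lessdot y$ the set $M_L(x)\cap J_L(y)$ has exactly one element $j_{xy}$; set $\mathcal{D}_L(x)=\{j_{yx}:y\lessdot x\}$ and $\mathcal{U}_L(x)=\{j_{xy}:x\lessdot y\}$. $L$ is semidistrim if it is compatibly dismantlable and $\mathcal{D}_L(x)$, $\mathcal{U}_L(x)$ are independent sets (no two elements adjacent) of $G_L$ for all $x\in L$. The crosscut complex of a lattice $L$ is the simplicial complex whose faces are the sets $A$ of atoms of $L$ with $\bigvee A\ne\hat1$. $L$ is crosscut simplicial if for all $u\le v$ in $L$, every proper subset of the set of atoms of the interval $[u,v]$ is a face of the crosscut complex of $[u,v]$. *)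

theory Defs
  imports Main "HOL-Library.FuncSet"
begin

text \<open>
  A finite lattice is represented by its carrier \<open>L\<close>, a finite nonempty subset of a lattice type
  that is closed under \<open>inf\<close> and \<open>sup\<close>; order, meet and join are those of the type. Every
  finite lattice arises in this way (take \<open>L = UNIV\<close>), and the intervals of \<open>L\<close>, to which the
  definitions below are also applied, are again carriers of this kind.
\<close>

definition finite_lattice :: "'a::lattice set \<Rightarrow> bool" where
  "finite_lattice L \<longleftrightarrow>
     finite L \<and> L \<noteq> {} \<and> (\<forall>x\<in>L. \<forall>y\<in>L. inf x y \<in> L \<and> sup x y \<in> L)"

definition bottom :: "'a::lattice set \<Rightarrow> 'a" where
  "bottom L = Inf_fin L"

definition top_elem :: "'a::lattice set \<Rightarrow> 'a" where
  "top_elem L = Sup_fin L"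

definition interval :: "'a::lattice set \<Rightarrow> 'a \<Rightarrow> 'a \<Rightarrow> 'a set" where
  "interval L u v = {x \<in> L. u \<le> x \<and> x \<le> v}"

text \<open>\<open>covered_by L x y\<close>: in \<open>L\<close>, the element \<open>y\<close> covers \<open>x\<close>.\<close>

definition covered_by :: "'a::lattice set \<Rightarrow> 'a \<Rightarrow> 'a \<Rightarrow> bool" where
  "covered_by L x y \<longleftrightarrow> x \<in> L \<and> y \<in> L \<and> x < y \<and> \<not> (\<exists>z\<in>L. x < z \<and> z < y)"

definition join_irr :: "'a::lattice set \<Rightarrow> 'a set" where
  "join_irr L = {j \<in> L. \<exists>!x. covered_by L x j}"

definition meet_irr :: "'a::lattice set \<Rightarrow> 'a set" where
  "meet_irr L = {m \<in> L. \<exists>!y. covered_by L m y}"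

definition lower_star :: "'a::lattice set \<Rightarrow> 'a \<Rightarrow> 'a" where
  "lower_star L j = (THE x. covered_by L x j)"

definition upper_star :: "'a::lattice set \<Rightarrow> 'a \<Rightarrow> 'a" where
  "upper_star L m = (THE y. covered_by L m y)"

text \<open>The operators max and min return the set of all maximal or minimal elements.\<close>

definition maximal_elems :: "'a::order set \<Rightarrow> 'a set" where
  "maximal_elems S = {z \<in> S. \<not> (\<exists>w\<in>S. z < w)}"

definition minimal_elems :: "'a::order set \<Rightarrow> 'a set" where
  "minimal_elems S = {z \<in> S. \<not> (\<exists>w\<in>S. w < z)}"

definition max_partners :: "'a::lattice set \<Rightarrow> 'a \<Rightarrow> 'a set" where
  "max_partners L j = maximal_elems {z \<in> L. lower_star L j = inf j z}"

definition min_partners :: "'a::lattice set \<Rightarrow> 'a \<Rightarrow> 'a set" where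
  "min_partners L m = minimal_elems {z \<in> L. upper_star L m = sup m z}"

text \<open>
  A pairing is a function on \<open>join_irr L\<close>; extensionality fixes its irrelevant values elsewhere,
  so that counting pairings with \<open>\<exists>!\<close> is meaningful.
\<close>

definition pairing :: "'a::lattice set \<Rightarrow> ('a \<Rightarrow> 'a) \<Rightarrow> bool" where
  "pairing L \<kappa> \<longleftrightarrow>
     \<kappa> \<in> extensional (join_irr L) \<and>
     bij_betw \<kappa> (join_irr L) (meet_irr L) \<and>
     (\<forall>j\<in>join_irr L. \<kappa> j \<in> max_partners L j) \<and>
     (\<forall>m\<in>meet_irr L. inv_into (join_irr L) \<kappa> m \<in> min_partners L m)"

definition uniquely_paired :: "'a::lattice set \<Rightarrow> bool" where
  "uniquely_paired L \<longleftrightarrow> (\<exists>!\<kappa>. pairing L \<kappa>)"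

definition kappa :: "'a::lattice set \<Rightarrow> 'a \<Rightarrow> 'a" where
  "kappa L = (THE \<kappa>. pairing L \<kappa>)"

definition kappa_inv :: "'a::lattice set \<Rightarrow> 'a \<Rightarrow> 'a" where
  "kappa_inv L = inv_into (join_irr L) (kappa L)"

definition prime_pair :: "'a::lattice set \<Rightarrow> 'a \<Rightarrow> 'a \<Rightarrow> bool" where
  "prime_pair L j0 m0 \<longleftrightarrow>
     j0 \<in> L \<and> m0 \<in> L \<and>
     L = interval L (bottom L) m0 \<union> interval L j0 (top_elem L) \<and>
     interval L (bottom L) m0 \<inter> interval L j0 (top_elem L) = {}"

text \<open>
  The recursion is well founded on finite lattices: both parts of a prime pair decomposition are
  nonempty, hence proper.
\<close>

inductive compatibly_dismantlable :: "'a::lattice set \<Rightarrow> bool" where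
  singleton:
    "uniquely_paired L \<Longrightarrow> card L = 1 \<Longrightarrow> compatibly_dismantlable L"
| split:
    "uniquely_paired L \<Longrightarrow>
     prime_pair L j0 m0 \<Longrightarrow>
     compatibly_dismantlable (interval L j0 (top_elem L)) \<Longrightarrow>
     bij_betw (\<lambda>j. sup j0 j) {j \<in> join_irr L. j0 \<le> kappa L j}
       (join_irr (interval L j0 (top_elem L))) \<Longrightarrow>
     (\<forall>j\<in>{j \<in> join_irr L. j0 \<le> kappa L j}.
        kappa (interval L j0 (top_elem L)) (sup j0 j) = kappa L j) \<Longrightarrow>
     compatibly_dismantlable (interval L (bottom L) m0) \<Longrightarrow>
     bij_betw (\<lambda>m. inf m0 m) {m \<in> meet_irr L. kappa_inv L m \<le> m0}
       (meet_irr (interval L (bottom L) m0)) \<Longrightarrow>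
     (\<forall>m\<in>{m \<in> meet_irr L. kappa_inv L m \<le> m0}.
        kappa_inv (interval L (bottom L) m0) (inf m0 m) = kappa_inv L m) \<Longrightarrow>
     compatibly_dismantlable L"

text \<open>The edge set of the Galois graph, whose vertex set is \<open>join_irr L\<close>.\<close>

definition galois_graph :: "'a::lattice set \<Rightarrow> 'a rel" where
  "galois_graph L =
     {(j, j'). j \<in> join_irr L \<and> j' \<in> join_irr L \<and> j \<noteq> j' \<and> \<not> j \<le> kappa L j'}"

definition independent_in :: "'a rel \<Rightarrow> 'a set \<Rightarrow> bool" where
  "independent_in E A \<longleftrightarrow> (\<forall>a\<in>A. \<forall>b\<in>A. (a, b) \<notin> E)"

definition J_below :: "'a::lattice set \<Rightarrow> 'a \<Rightarrow> 'a set" where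
  "J_below L x = {j \<in> join_irr L. j \<le> x}"

definition M_above :: "'a::lattice set \<Rightarrow> 'a \<Rightarrow> 'a set" where
  "M_above L x = {j \<in> join_irr L. x \<le> kappa L j}"

text \<open>
  The label of a cover \<open>x \<lessdot> y\<close>; for a compatibly dismantlable \<open>L\<close> the intersection is known to
  be a singleton.
\<close>

definition cover_label :: "'a::lattice set \<Rightarrow> 'a \<Rightarrow> 'a \<Rightarrow> 'a" where
  "cover_label L x y = (THE j. j \<in> M_above L x \<inter> J_below L y)"

definition down_labels :: "'a::lattice set \<Rightarrow> 'a \<Rightarrow> 'a set" where
  "down_labels L x = {cover_label L y x | y. covered_by L y x}"

definition up_labels :: "'a::lattice set \<Rightarrow> 'a \<Rightarrow> 'a set" where
  "up_labels L x = {cover_label L x y | y. covered_by L x y}"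

definition semidistrim :: "'a::lattice set \<Rightarrow> bool" where
  "semidistrim L \<longleftrightarrow>
     compatibly_dismantlable L \<and>
     (\<forall>x\<in>L. independent_in (galois_graph L) (down_labels L x) \<and>
            independent_in (galois_graph L) (up_labels L x))"

definition atoms :: "'a::lattice set \<Rightarrow> 'a set" where
  "atoms L = {a. covered_by L (bottom L) a}"

text \<open>Inserting the bottom element makes the empty join equal to it, and changes no other join.\<close>

definition join_of :: "'a::lattice set \<Rightarrow> 'a set \<Rightarrow> 'a" where
  "join_of L A = Sup_fin (insert (bottom L) A)"

definition crosscut_complex :: "'a::lattice set \<Rightarrow> 'a set set" where
  "crosscut_complex L = {A. A \<subseteq> atoms L \<and> join_of L A \<noteq> top_elem L}"

definition crosscut_simplicial :: "'a::lattice set \<Rightarrow> bool" where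
  "crosscut_simplicial L \<longleftrightarrow>
     (\<forall>u\<in>L. \<forall>v\<in>L. u \<le> v \<longrightarrow>
        (\<forall>A. A \<subset> atoms (interval L u v) \<longrightarrow> A \<in> crosscut_complex (interval L u v)))"

end

theory Submission
  imports Defs
begin

text \<open>
  The cover labels make sense by induction along prime pairs: covers inside one of the two parts
  inherit their label, and a cover from \<open>[0, m\<^sub>0]\<close> to \<open>[j\<^sub>0, 1]\<close> can only have label \<open>j\<^sub>0\<close>.
  Now let \<open>y\<^sub>i\<close> be the atoms of \<open>[u, v]\<close> and \<open>j\<^sub>i\<close> the label of \<open>u \<lessdot> y\<^sub>i\<close>, so that
  \<open>y\<^sub>i = u \<squnion> j\<^sub>i\<close>. Independence of the up-labels of \<open>u\<close> says \<open>j\<^sub>i \<le> \<kappa> j\<^sub>l\<close> for \<open>i \<noteq> l\<close>, so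
  \<open>\<kappa> j\<^sub>l\<close> is above every atom except \<open>y\<^sub>l\<close>; hence the atoms other than \<open>y\<^sub>l\<close> do not join to \<open>v\<close>.
\<close>

section \<open>Bounds and intervals of a finite lattice\<close>

lemma finite_lattice_bottom:
  assumes "finite_lattice L"
  shows "bottom L \<in> L" and "x \<in> L \<Longrightarrow> bottom L \<le> x"
proof -
  have *: "finite L" "L \<noteq> {}" "\<And>x y. x \<in> L \<Longrightarrow> y \<in> L \<Longrightarrow> inf x y \<in> L"
    using assms by (auto simp: finite_lattice_def)
  have "Inf_fin A \<in> L" if "finite A" "A \<noteq> {}" "A \<subseteq> L" for A
    using that by (induction rule: finite_ne_induct) (use *(3) in auto)
  then show "bottom L \<in> L" using * by (simp add: bottom_def)
  show "x \<in> L \<Longrightarrow> bottom L \<le> x"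
    unfolding bottom_def using *(1) by (simp add: Inf_fin.coboundedI)
qed

lemma finite_lattice_top_elem:
  assumes "finite_lattice L"
  shows "top_elem L \<in> L" and "x \<in> L \<Longrightarrow> x \<le> top_elem L"
proof -
  have *: "finite L" "L \<noteq> {}" "\<And>x y. x \<in> L \<Longrightarrow> y \<in> L \<Longrightarrow> sup x y \<in> L"
    using assms by (auto simp: finite_lattice_def)
  have "Sup_fin A \<in> L" if "finite A" "A \<noteq> {}" "A \<subseteq> L" for A
    using that by (induction rule: finite_ne_induct) (use *(3) in auto)
  then show "top_elem L \<in> L" using * by (simp add: top_elem_def)
  show "x \<in> L \<Longrightarrow> x \<le> top_elem L"
    unfolding top_elem_def using *(1) by (simp add: Sup_fin.coboundedI)
qed

lemma finite_lattice_interval: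
  assumes "finite_lattice L" "u \<in> L" "v \<in> L" "u \<le> v"
  shows "finite_lattice (interval L u v)"
  using assms by (auto simp: finite_lattice_def interval_def intro: le_infI1 le_supI1)

lemma bottom_interval:
  assumes "finite_lattice L" "u \<in> L" "v \<in> L" "u \<le> v"
  shows "bottom (interval L u v) = u"
  using finite_lattice_bottom[OF finite_lattice_interval[OF assms]] assms
  by (auto simp: interval_def intro!: order.antisym)

lemma top_elem_interval:
  assumes "finite_lattice L" "u \<in> L" "v \<in> L" "u \<le> v"
  shows "top_elem (interval L u v) = v"
  using finite_lattice_top_elem[OF finite_lattice_interval[OF assms]] assms
  by (auto simp: interval_def intro!: order.antisym)

text \<open>Intervals are convex: if both ends of a cover lie in the interval, so does any element
  of \<open>L\<close> strictly between them.\<close>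

lemma covered_by_interval:
  "covered_by (interval L u v) x y \<longleftrightarrow> covered_by L x y \<and> u \<le> x \<and> y \<le> v"
  by (auto simp: covered_by_def interval_def intro: less_imp_le order_trans)

section \<open>Join-irreducibles and the pairing \<open>kappa\<close>\<close>

lemma le_lower_cover:
  assumes "finite L" "x \<in> L" "y \<in> L" "x < y"
  obtains w where "covered_by L w y" "x \<le> w"
proof -
  let ?S = "{z \<in> L. x \<le> z \<and> z < y}"
  have "finite ?S" "x \<in> ?S" using assms by auto
  then obtain w where w: "w \<in> ?S" "x \<le> w" "\<forall>b\<in>?S. w \<le> b \<longrightarrow> w = b"
    using finite_has_maximal2 by blast
  have "covered_by L w y"
    using w assms by (auto simp: covered_by_def intro: less_imp_le order_trans)
  with w(2) show ?thesis using that by blast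
qed

lemma covered_by_lower_star:
  assumes "j \<in> join_irr L"
  shows "covered_by L (lower_star L j) j"
  using assms unfolding join_irr_def lower_star_def by (auto intro: theI')

text \<open>Some lower cover of \<open>j\<close> lies above \<open>x\<close>, and \<open>j\<close>
  has only one lower cover.\<close>

lemma le_lower_star:
  assumes "finite L" "j \<in> join_irr L" "x \<in> L" "x < j"
  shows "x \<le> lower_star L j"
proof -
  have "j \<in> L" using assms(2) by (simp add: join_irr_def)
  then obtain w where "covered_by L w j" "x \<le> w"
    using le_lower_cover assms by blast
  then show ?thesis
    using covered_by_lower_star[OF assms(2)] assms(2) by (auto simp: join_irr_def)
qed

lemma pairing_kappa:
  assumes "uniquely_paired L"
  shows "pairing L (kappa L)"
  using assms unfolding uniquely_paired_def kappa_def by (rule theI')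

lemma
  assumes "uniquely_paired L"
  shows bij_betw_kappa: "bij_betw (kappa L) (join_irr L) (meet_irr L)"
    and kappa_in_max_partners: "j \<in> join_irr L \<Longrightarrow> kappa L j \<in> max_partners L j"
  using pairing_kappa[OF assms] by (auto simp: pairing_def)

lemma
  assumes "uniquely_paired L"
  shows kappa_in_meet_irr: "j \<in> join_irr L \<Longrightarrow> kappa L j \<in> meet_irr L"
    and kappa_inv_kappa: "j \<in> join_irr L \<Longrightarrow> kappa_inv L (kappa L j) = j"
    and kappa_inv_in_join_irr: "m \<in> meet_irr L \<Longrightarrow> kappa_inv L m \<in> join_irr L"
    and kappa_kappa_inv: "m \<in> meet_irr L \<Longrightarrow> kappa L (kappa_inv L m) = m"
  using bij_betw_kappa[OF assms] unfolding kappa_inv_def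
  by (auto simp: bij_betw_def inv_into_into f_inv_into_f)

lemma
  assumes "uniquely_paired L" "j \<in> join_irr L"
  shows kappa_in: "kappa L j \<in> L"
    and lower_star_eq_inf_kappa: "lower_star L j = inf j (kappa L j)"
  using kappa_in_max_partners[OF assms] by (auto simp: max_partners_def maximal_elems_def)

text \<open>Otherwise \<open>inf j (kappa L j)\<close> would be \<open>j\<close>, but it is the
  lower cover of \<open>j\<close>.\<close>

lemma not_le_kappa:
  assumes "uniquely_paired L" "j \<in> join_irr L"
  shows "\<not> j \<le> kappa L j"
  using covered_by_lower_star[OF assms(2)] lower_star_eq_inf_kappa[OF assms]
  by (auto simp: covered_by_def inf.absorb1)

lemma uniquely_paired_of_compatibly_dismantlable:
  "compatibly_dismantlable L \<Longrightarrow> uniquely_paired L"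
  by (erule compatibly_dismantlable.cases) simp_all

section \<open>Prime pairs\<close>

lemma
  assumes "finite_lattice L" "prime_pair L j0 m0"
  shows prime_pair_dichotomy: "x \<in> L \<Longrightarrow> x \<le> m0 \<or> j0 \<le> x"
    and prime_pair_disjoint: "x \<in> L \<Longrightarrow> x \<le> m0 \<Longrightarrow> \<not> j0 \<le> x"
  using assms finite_lattice_bottom(2)[OF assms(1)] finite_lattice_top_elem(2)[OF assms(1)]
  by (auto simp: prime_pair_def interval_def)

text \<open>By the dichotomy, everything strictly below \<open>j0\<close> is below
  \<open>m0\<close>, so \<open>inf j0 m0\<close> is the greatest element strictly below
  \<open>j0\<close> and hence its only lower cover.\<close>

lemma prime_pair_join_irr:
  assumes L: "finite_lattice L" and pp: "prime_pair L j0 m0"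
  shows "j0 \<in> join_irr L" and "lower_star L j0 = inf j0 m0"
proof -
  have in_L: "j0 \<in> L" "m0 \<in> L" using pp by (auto simp: prime_pair_def)
  have in_L': "inf j0 m0 \<in> L" using L in_L by (simp add: finite_lattice_def)
  have less: "inf j0 m0 < j0"
    using prime_pair_disjoint[OF L pp in_L(1)] by (metis in_L(2) inf.absorb_iff1 inf.cobounded1 inf.cobounded2 less_le)
  have below: "z \<le> inf j0 m0" if "z \<in> L" "z < j0" for z
    using prime_pair_dichotomy[OF L pp that(1)] that(2) by auto
  have cover: "covered_by L x j0 \<longleftrightarrow> x = inf j0 m0" for x
    using in_L in_L' less below unfolding covered_by_def
    by (metis leD le_imp_less_or_eq)
  then show "j0 \<in> join_irr L" "lower_star L j0 = inf j0 m0"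
    using in_L by (auto simp: join_irr_def lower_star_def)
qed

text \<open>Not being above \<open>j0\<close>, the element \<open>kappa L j0\<close> is below
  \<open>m0\<close> by the dichotomy. Since \<open>m0\<close> also meets \<open>j0\<close> in
  \<open>lower_star L j0\<close>, maximality of \<open>kappa L j0\<close> forces equality.\<close>

lemma prime_pair_kappa:
  assumes L: "finite_lattice L" and pp: "prime_pair L j0 m0" and "uniquely_paired L"
  shows "kappa L j0 = m0"
proof -
  note j0 = prime_pair_join_irr[OF L pp]
  have "kappa L j0 \<le> m0"
    using prime_pair_dichotomy[OF L pp] kappa_in[OF assms(3) j0(1)] not_le_kappa[OF assms(3) j0(1)]
    by blast
  moreover have "\<not> kappa L j0 < m0"
    using kappa_in_max_partners[OF assms(3) j0(1)] j0(2) pp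
    by (auto simp: max_partners_def maximal_elems_def prime_pair_def)
  ultimately show ?thesis by (simp add: less_le)
qed

section \<open>Existence and uniqueness of cover labels\<close>

text \<open>Joining with \<open>j0\<close> matches the label candidates in \<open>L\<close> with
  those in the upper part: \<open>j0 \<le> x \<le> kappa L j\<close> puts \<open>j\<close> in the
  domain of the bijection, \<open>kappa\<close> is preserved, and as \<open>j0 \<le> y\<close>, the
  bounds \<open>j \<le> y\<close> and \<open>sup j0 j \<le> y\<close> are equivalent.\<close>

lemma cover_label_ex1_upper:
  assumes bij: "bij_betw (\<lambda>j. sup j0 j) {j \<in> join_irr L. j0 \<le> kappa L j}
                (join_irr (interval L j0 (top_elem L)))"
    and kap: "\<forall>j\<in>{j \<in> join_irr L. j0 \<le> kappa L j}.
                kappa (interval L j0 (top_elem L)) (sup j0 j) = kappa L j"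
    and ex1: "\<exists>!j. j \<in> M_above (interval L j0 (top_elem L)) x \<inter>
                        J_below (interval L j0 (top_elem L)) y"
    and le: "j0 \<le> x" "j0 \<le> y"
  shows "\<exists>!j. j \<in> M_above L x \<inter> J_below L y"
proof -
  let ?K = "interval L j0 (top_elem L)" and ?D = "{j \<in> join_irr L. j0 \<le> kappa L j}"
  obtain j' where j': "j' \<in> join_irr ?K" "x \<le> kappa ?K j'" "j' \<le> y"
    and uniq: "\<And>i. i \<in> join_irr ?K \<Longrightarrow> x \<le> kappa ?K i \<Longrightarrow> i \<le> y \<Longrightarrow> i = j'"
    using ex1 unfolding M_above_def J_below_def by blast
  obtain j where j: "j \<in> ?D" "j' = sup j0 j"
    using bij j'(1) unfolding bij_betw_def by blast
  show ?thesis
  proof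
    show "j \<in> M_above L x \<inter> J_below L y"
      using j j' kap by (auto simp: M_above_def J_below_def)
  next
    fix i assume i: "i \<in> M_above L x \<inter> J_below L y"
    then have iD: "i \<in> ?D" using le(1) by (auto simp: M_above_def)
    have "sup j0 i = j'"
    proof (rule uniq)
      show "sup j0 i \<in> join_irr ?K" using bij iD unfolding bij_betw_def by blast
      show "x \<le> kappa ?K (sup j0 i)" using kap iD i by (auto simp: M_above_def)
      show "sup j0 i \<le> y" using i le by (auto simp: J_below_def)
    qed
    then show "i = j" using bij iD j by (auto simp: bij_betw_def dest: inj_onD)
  qed
qed

text \<open>Here the bijection acts on meet-irreducibles, so a candidate \<open>i\<close> is
  transported through \<open>kappa L i\<close>. As \<open>kappa_inv\<close> is preserved, the label
  is the same element in both lattices, while \<open>x \<le> m0\<close> makes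
  \<open>x \<le> m\<close> and \<open>x \<le> inf m0 m\<close> equivalent.\<close>

lemma cover_label_ex1_lower:
  assumes up: "uniquely_paired L"
    and upK: "uniquely_paired (interval L (bottom L) m0)"
    and bij: "bij_betw (\<lambda>m. inf m0 m) {m \<in> meet_irr L. kappa_inv L m \<le> m0}
                (meet_irr (interval L (bottom L) m0))"
    and kap: "\<forall>m\<in>{m \<in> meet_irr L. kappa_inv L m \<le> m0}.
                kappa_inv (interval L (bottom L) m0) (inf m0 m) = kappa_inv L m"
    and ex1: "\<exists>!j. j \<in> M_above (interval L (bottom L) m0) x \<inter>
                        J_below (interval L (bottom L) m0) y"
    and le: "x \<le> m0" "y \<le> m0"
  shows "\<exists>!j. j \<in> M_above L x \<inter> J_below L y"
proof -
  let ?K = "interval L (bottom L) m0" and ?D = "{m \<in> meet_irr L. kappa_inv L m \<le> m0}"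
  obtain j where j: "j \<in> join_irr ?K" "x \<le> kappa ?K j" "j \<le> y"
    and uniq: "\<And>i. i \<in> join_irr ?K \<Longrightarrow> x \<le> kappa ?K i \<Longrightarrow> i \<le> y \<Longrightarrow> i = j"
    using ex1 unfolding M_above_def J_below_def by blast
  obtain m where m: "m \<in> ?D" "kappa ?K j = inf m0 m"
    using bij kappa_in_meet_irr[OF upK j(1)] unfolding bij_betw_def by blast
  have jm: "kappa_inv L m = j"
    using kap m kappa_inv_kappa[OF upK j(1)] by auto
  show ?thesis
  proof
    have "j \<in> join_irr L" "kappa L j = m"
      using jm m(1) kappa_inv_in_join_irr[OF up] kappa_kappa_inv[OF up] by auto
    then show "j \<in> M_above L x \<inter> J_below L y"
      using j m by (auto simp: M_above_def J_below_def)
  next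
    fix i assume i: "i \<in> M_above L x \<inter> J_below L y"
    then have iL: "i \<in> join_irr L" "x \<le> kappa L i" "i \<le> y"
      by (auto simp: M_above_def J_below_def)
    have iD: "kappa L i \<in> ?D"
      using iL le kappa_in_meet_irr[OF up] kappa_inv_kappa[OF up] by auto
    then have mK: "inf m0 (kappa L i) \<in> meet_irr ?K" using bij unfolding bij_betw_def by blast
    have iK: "kappa_inv ?K (inf m0 (kappa L i)) = i"
      using kap iD kappa_inv_kappa[OF up iL(1)] by auto
    show "i = j"
    proof (rule uniq)
      show "i \<in> join_irr ?K" using kappa_inv_in_join_irr[OF upK mK] iK by simp
      show "x \<le> kappa ?K i" using kappa_kappa_inv[OF upK mK] iK iL le by simp
      show "i \<le> y" by fact
    qed
  qed
qed

lemma cover_label_ex1_crossing: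
  assumes L: "finite_lattice L" and up: "uniquely_paired L" and pp: "prime_pair L j0 m0"
    and cov: "covered_by L x y" and le: "x \<le> m0" "j0 \<le> y"
  shows "\<exists>!j. j \<in> M_above L x \<inter> J_below L y"
proof
  have in_L: "j0 \<in> L" "m0 \<in> L" "x \<in> L" "y \<in> L" using pp cov by (auto simp: prime_pair_def covered_by_def)
  have between: "z = x \<or> z = y" if "z \<in> L" "x \<le> z" "z \<le> y" for z
    using cov that by (auto simp: covered_by_def less_le)
  have "sup x j0 \<in> L" "inf y m0 \<in> L" using L in_L by (auto simp: finite_lattice_def)
  have "x \<le> y" using cov by (auto simp: covered_by_def)
  have "\<not> j0 \<le> x" "\<not> y \<le> m0"
    using prime_pair_disjoint[OF L pp] in_L le by auto
  \<comment> \<open>Since nothing lies strictly between \<open>x\<close> and \<open>y\<close>, the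
    prime pair recovers each end of the cover from the other. These two equations locate any further
    candidate \<open>j\<close> below.\<close>
  have sup_eq: "sup x j0 = y"
    using between[OF \<open>sup x j0 \<in> L\<close>] \<open>x \<le> y\<close> \<open>\<not> j0 \<le> x\<close> le
    by (metis sup.cobounded1 sup.cobounded2 sup_least)
  have inf_eq: "inf y m0 = x"
    using between[OF \<open>inf y m0 \<in> L\<close>] \<open>x \<le> y\<close> \<open>\<not> y \<le> m0\<close> le
    by (metis inf.cobounded1 inf.cobounded2 inf_greatest)
  show "j0 \<in> M_above L x \<inter> J_below L y"
    using prime_pair_join_irr(1)[OF L pp] prime_pair_kappa[OF L pp up] le
    by (simp add: M_above_def J_below_def)
  fix j assume "j \<in> M_above L x \<inter> J_below L y"
  then have j: "j \<in> join_irr L" "x \<le> kappa L j" "j \<le> y"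
    by (auto simp: M_above_def J_below_def)
  have "j \<in> L" using j(1) by (simp add: join_irr_def)
  have nle: "\<not> j \<le> kappa L j" by (rule not_le_kappa[OF up j(1)])
  \<comment> \<open>Otherwise \<open>j \<le> y = sup x j0 \<le> kappa L j\<close>.\<close>
  have "\<not> j0 \<le> kappa L j"
    using sup_eq j nle by (metis order_trans sup_least)
  \<comment> \<open>Otherwise \<open>j \<le> inf y m0 = x \<le> kappa L j\<close>.\<close>
  moreover have "\<not> j \<le> m0"
    using inf_eq j nle by (metis order_trans inf_greatest)
  then have "j0 \<le> j" using prime_pair_dichotomy[OF L pp \<open>j \<in> L\<close>] by blast
  \<comment> \<open>If \<open>j\<close> were strictly above \<open>j0\<close>, then
    \<open>j0 \<le> lower_star L j \<le> kappa L j\<close>, which is excluded.\<close>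
  moreover have "\<not> j0 < j"
  proof
    assume "j0 < j"
    then have "j0 \<le> lower_star L j"
      using L le_lower_star j(1) in_L(1) by (auto simp: finite_lattice_def)
    with \<open>\<not> j0 \<le> kappa L j\<close> show False
      using lower_star_eq_inf_kappa[OF up j(1)] by simp
  qed
  ultimately show "j = j0" by (simp add: less_le)
qed

lemma cover_label_ex1:
  assumes "compatibly_dismantlable L" "finite_lattice L" "covered_by L x y"
  shows "\<exists>!j. j \<in> M_above L x \<inter> J_below L y"
  using assms
proof (induction arbitrary: x y rule: compatibly_dismantlable.induct)
  case (singleton L)
  then show ?case by (auto simp: covered_by_def card_1_singleton_iff)
next
  case (split L j0 m0)
  note L = split.prems(1) and cov = split.prems(2) and pp = split.hyps(2) and up = split.hyps(1)
  have in_L: "x \<in> L" "y \<in> L" "x \<le> y" "j0 \<in> L" "m0 \<in> L"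
    using cov pp by (auto simp: covered_by_def prime_pair_def)
  note bt = finite_lattice_bottom[OF L] finite_lattice_top_elem[OF L]
  \<comment> \<open>A cover that starts in the upper part or ends in the lower part stays there; any
    other cover crosses upwards from the lower part.\<close>
  consider "j0 \<le> x" | "y \<le> m0" | "x \<le> m0" "j0 \<le> y"
    using prime_pair_dichotomy[OF L pp] in_L by blast
  then show ?case
  proof cases
    case 1
    then have "j0 \<le> y" using in_L by simp
    have "\<exists>!j. j \<in> M_above (interval L j0 (top_elem L)) x \<inter> J_below (interval L j0 (top_elem L)) y"
      by (rule split.IH(1)) (use 1 in_L bt cov L in
          \<open>auto simp: covered_by_interval intro: finite_lattice_interval\<close>)
    from cover_label_ex1_upper[OF split.hyps(4,5) this 1 \<open>j0 \<le> y\<close>]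
    show ?thesis .
  next
    case 2
    then have "x \<le> m0" using in_L by simp
    have "\<exists>!j. j \<in> M_above (interval L (bottom L) m0) x \<inter> J_below (interval L (bottom L) m0) y"
      by (rule split.IH(2)) (use 2 in_L bt cov L in
          \<open>auto simp: covered_by_interval intro: finite_lattice_interval\<close>)
    from cover_label_ex1_lower[OF up uniquely_paired_of_compatibly_dismantlable[OF split.hyps(6)]
        split.hyps(7,8) this \<open>x \<le> m0\<close> 2]
    show ?thesis .
  next
    case 3
    then show ?thesis by (rule cover_label_ex1_crossing[OF L up pp cov])
  qed
qed

section \<open>Labels of the covers of one element, and atoms of intervals\<close>

lemma cover_label_props:
  assumes "compatibly_dismantlable L" "finite_lattice L" "covered_by L x y"
  shows "cover_label L x y \<in> join_irr L" "x \<le> kappa L (cover_label L x y)"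
    "sup x (cover_label L x y) = y"
proof -
  let ?j = "cover_label L x y"
  have "?j \<in> M_above L x \<inter> J_below L y"
    unfolding cover_label_def by (rule theI'[OF cover_label_ex1[OF assms]])
  then have j: "?j \<in> join_irr L" "x \<le> kappa L ?j" "?j \<le> y"
    by (auto simp: M_above_def J_below_def)
  show "?j \<in> join_irr L" "x \<le> kappa L ?j" by fact+
  \<comment> \<open>Otherwise \<open>?j \<le> x \<le> kappa L ?j\<close>. Hence
    \<open>sup x ?j\<close> is strictly above \<open>x\<close> and at most \<open>y\<close>, which
    leaves only \<open>y\<close>.\<close>
  have "\<not> ?j \<le> x"
    using not_le_kappa[OF uniquely_paired_of_compatibly_dismantlable[OF assms(1)] j(1)] j(2)
      order_trans by blast
  have "sup x ?j \<in> L"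
    using assms(2,3) j(1) by (auto simp: finite_lattice_def covered_by_def join_irr_def)
  moreover have "x < sup x ?j" using \<open>\<not> ?j \<le> x\<close> by (metis less_le sup.cobounded1 sup.cobounded2)
  moreover have "sup x ?j \<le> y" using assms(3) j(3) by (auto simp: covered_by_def)
  ultimately show "sup x ?j = y" using assms(3) by (auto simp: covered_by_def less_le)
qed

lemma semidistrim_cover_le_kappa:
  assumes "finite_lattice L" "semidistrim L" "covered_by L u y" "covered_by L u z" "y \<noteq> z"
  shows "y \<le> kappa L (cover_label L u z)"
proof -
  have cd: "compatibly_dismantlable L" using assms(2) by (simp add: semidistrim_def)
  note y = cover_label_props[OF cd assms(1,3)] and z = cover_label_props[OF cd assms(1,4)]
  \<comment> \<open>Each cover is the join of \<open>u\<close> with its label, so equal labels would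
    give equal covers.\<close>
  have "cover_label L u y \<noteq> cover_label L u z" using y(3) z(3) assms(5) by auto
  moreover have "u \<in> L" using assms(3) by (simp add: covered_by_def)
  then have "independent_in (galois_graph L) (up_labels L u)"
    using assms(2) by (simp add: semidistrim_def)
  then have "(cover_label L u y, cover_label L u z) \<notin> galois_graph L"
    using assms(3,4) unfolding independent_in_def up_labels_def by blast
  \<comment> \<open>Between distinct vertices, the absence of an edge is exactly this
    inequality.\<close>
  ultimately have "cover_label L u y \<le> kappa L (cover_label L u z)"
    using y(1) z(1) by (simp add: galois_graph_def)
  then have "sup u (cover_label L u y) \<le> kappa L (cover_label L u z)" using z(2) by simp
  then show ?thesis by (simp add: y(3))
qed

theorem theorem8p1:
  fixes L :: "'a::lattice set"
  assumes "finite_lattice L" and "semidistrim L"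
  shows "crosscut_simplicial L"
  unfolding crosscut_simplicial_def
proof (intro ballI impI allI)
  fix u v A
  assume uv: "u \<in> L" "v \<in> L" "u \<le> v" and A: "A \<subset> atoms (interval L u v)"
  have cd: "compatibly_dismantlable L" using assms(2) by (simp add: semidistrim_def)
  have atoms: "atoms (interval L u v) = {y. covered_by L u y \<and> y \<le> v}"
    using bottom_interval[OF assms(1) uv] by (auto simp: atoms_def covered_by_interval)
  \<comment> \<open>The atom \<open>z\<close> missed by \<open>A\<close> supplies, through its
    label, an upper bound \<open>?m\<close> of \<open>A\<close> that is not above
    \<open>v\<close>.\<close>
  obtain z where z: "covered_by L u z" "z \<le> v" "z \<notin> A" using A atoms by blast
  let ?m = "kappa L (cover_label L u z)"
  note j = cover_label_props[OF cd assms(1) z(1)]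
  have "A \<subseteq> L" using A atoms by (auto simp: covered_by_def)
  then have "finite A" using assms(1) by (auto simp: finite_lattice_def intro: finite_subset)
  \<comment> \<open>The element \<open>u\<close> is included because \<open>join_of\<close> inserts
    the bottom of the interval.\<close>
  have "x \<le> ?m" if "x \<in> insert u A" for x
    using that j(2) A z semidistrim_cover_le_kappa[OF assms _ z(1)] unfolding atoms by blast
  then have "join_of (interval L u v) A \<le> ?m"
    unfolding join_of_def bottom_interval[OF assms(1) uv]
    using \<open>finite A\<close> by (intro Sup_fin.boundedI) auto
  \<comment> \<open>The label of \<open>z\<close> is below \<open>z\<close>, hence below
    \<open>v\<close>, but not below its own image \<open>?m\<close> under
    \<open>kappa L\<close>.\<close>
  moreover have "\<not> v \<le> ?m"
  proof
    assume "v \<le> ?m"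
    moreover have "cover_label L u z \<le> z" using j(3) by (metis sup.cobounded2)
    ultimately have "cover_label L u z \<le> ?m" using z(2) by (blast intro: order_trans)
    with not_le_kappa[OF uniquely_paired_of_compatibly_dismantlable[OF cd] j(1)]
    show False by contradiction
  qed
  ultimately have "join_of (interval L u v) A \<noteq> v" by auto
  then show "A \<in> crosscut_complex (interval L u v)"
    using A top_elem_interval[OF assms(1) uv] by (auto simp: crosscut_complex_def)
qed

end
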